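(* Let $\{\sigma_n\colon R_n\to\mathscr{W}\mid n\geqslant1\}$ be $\mathscr{W}$-measures on countable atomless Boolean algebras $R_n$, each with Stone space $X_n$ homeomorphic to the Cantor set, and suppose $\{(R_n,\sigma_n)\mid n\geqslant1\}$ are incompatible. Let $(R,\sigma)$ be their completion. Then $R$ is not $\sigma$-primitive.
   Context: $\mathscr{W}=\omega_1\cup\{o\}$ ($\omega_1$ the countable ordinals, $o<\xi$ for all $\xi$), a commutative monoid under $a+b=\max\{a,b\}$ with zero $o$. A $\mathscr{W}$-measure on a Boolean ring $S$ is $\sigma\colon S\to\mathscr{W}$ with $\sigma(A\dotplus B)=\max\{\sigma(A),\sigma(B)\}$ for disjoint $A,B$ and $\sigma(A)=o$ iff $A=0$. Completion: let $X$ be the one-point compactification at a point $c$ of the disjoint union of the $X_n$, so $X=\{c\}\cup\bigcup_n X_n$; let $R$ be the Boolean algebra of compact open subsets of $X$, with each $R_n$ viewed as the subring of compact open subsets of $X_n$. Let $A_n=\{c\}\cup\bigcup_{m\geqslant n}X_m$. The completion is the additive measure $\sigma\colon R\to\mathscr{W}$ with $\sigma(B)=\sigma_n(B)$ for $B\in R_n$ and $\sigma(A_n)=\sup\{\sigma_m(X_m)\mid m\geqslant n\}$ (extended additively). Let $R_{-n}=\{A\in R\mid A\subseteq\bigcup_{m\neq n}X_m\}$. A map $\alpha\colon R_n\to R$ is measure-preserving if $\sigma(A\alpha)=\sigma_n(A)$ for all $A\in R_n$. The family is incompatible if for each $n$ there is no measure-preserving isomorphism between $R_n$ and any principal ideal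 $(B)=\{C\in R\mid C\subseteq B\}$ with $B\in R_{-n}$. For a measure $\sigma$ on $R$ and $A,B\in R$, $A\cong_\sigma B$ means there is an isomorphism $\alpha\colon(A)\to(B)$ with $\sigma(C\alpha)=\sigma(C)$ for all $C\in(A)$; $A$ is $\sigma$-PI if for all $B\subseteq A$ in $R$, $B\cong_\sigma A$ or $A-B\cong_\sigma A$; $R$ is $\sigma$-primitive if every element is a finite disjoint union of $\sigma$-PI elements. *)

theory Defs
  imports
    "HOL-Analysis.Analysis"
    "HOL-Algebra.QuotRing"
    "HOL-Library.Option_ord"
    "HOL-Library.Countable_Set_Type"
begin

unbundle cardinal_syntax

(* As a cardinal order, cardSuc natLeq has the least order type of its cardinality aleph_1,
   which is omega_1; the two countability lemmas below pin this down. *)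
typedef omega1 = "Field (cardSuc natLeq)"
proof -
  have "infinite (Field (cardSuc natLeq))"
    by (simp add: cardSuc_finite[OF natLeq_Card_order] Field_natLeq)
  then have "Field (cardSuc natLeq) \<noteq> {}" by auto
  then show ?thesis by blast
qed

lemma Well_order_omega1: "Well_order (cardSuc natLeq)"
  using card_order_on_well_order_on cardSuc_Card_order natLeq_Card_order by blast

instantiation omega1 :: linorder
begin

definition less_eq_omega1 :: "omega1 \<Rightarrow> omega1 \<Rightarrow> bool" where
  "x \<le> y \<longleftrightarrow> (Rep_omega1 x, Rep_omega1 y) \<in> cardSuc natLeq"

definition less_omega1 :: "omega1 \<Rightarrow> omega1 \<Rightarrow> bool" where
  "x < y \<longleftrightarrow> x \<le> y \<and> \<not> y \<le> x" for x y :: omega1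

instance
proof
  have lin: "refl_on (Field (cardSuc natLeq)) (cardSuc natLeq)" "trans (cardSuc natLeq)"
    "antisym (cardSuc natLeq)" "total_on (Field (cardSuc natLeq)) (cardSuc natLeq)"
    using Well_order_omega1
    by (auto simp: well_order_on_def linear_order_on_def partial_order_on_def preorder_on_def)
  fix x y z :: omega1
  show "x < y \<longleftrightarrow> x \<le> y \<and> \<not> y \<le> x" by (rule less_omega1_def)
  show "x \<le> x"
    unfolding less_eq_omega1_def by (rule refl_onD[OF lin(1) Rep_omega1])
  show "x \<le> y \<Longrightarrow> y \<le> z \<Longrightarrow> x \<le> z"
    using lin(2) unfolding less_eq_omega1_def by (blast dest: transD)
  show "x \<le> y \<Longrightarrow> y \<le> x \<Longrightarrow> x = y"
    using lin(3) unfolding less_eq_omega1_def by (metis antisymD Rep_omega1_inject)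
  show "x \<le> y \<or> y \<le> x"
    unfolding less_eq_omega1_def
    using refl_onD[OF lin(1) Rep_omega1] lin(4)[unfolded total_on_def, rule_format, OF Rep_omega1 Rep_omega1]
    by (metis Rep_omega1_inject)
qed

end

lemma less_omega1_iff:
  "x < y \<longleftrightarrow> (Rep_omega1 x, Rep_omega1 y) \<in> cardSuc natLeq - Id"
  by (auto simp: less_le less_eq_omega1_def Rep_omega1_inject)

instance omega1 :: wellorder
proof (rule wf_wellorderI)
  have "wf (cardSuc natLeq - Id)"
    using Well_order_omega1 by (simp add: well_order_on_def)
  then have "wf (inv_image (cardSuc natLeq - Id) Rep_omega1)"
    by (rule wf_inv_image)
  then show "wf {(x, y). x < (y :: omega1)}"
    by (simp add: inv_image_def less_omega1_iff)
qed standard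

lemma uncountable_omega1: "uncountable (UNIV :: omega1 set)"
proof
  assume "countable (UNIV :: omega1 set)"
  then have "countable (Rep_omega1 ` UNIV)" by (rule countable_image)
  then have "countable (Field (cardSuc natLeq))"
    by (simp add: type_definition.Rep_range[OF type_definition_omega1])
  then have "|Field (cardSuc natLeq)| \<le>o natLeq"
    by (simp add: countable_card_le_natLeq)
  moreover have "|Field (cardSuc natLeq)| =o cardSuc natLeq"
    by (simp add: card_of_Field_ordIso cardSuc_Card_order natLeq_Card_order)
  ultimately have "cardSuc natLeq \<le>o natLeq"
    using ordIso_ordLeq_trans ordIso_symmetric by blast
  then show False
    using cardSuc_greater[OF natLeq_Card_order] not_ordLess_ordLeq by blast
qed

lemma countable_initial_segment_omega1: "countable {..< x :: omega1}"
proof -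
  have "|underS (cardSuc natLeq) (Rep_omega1 x)| <o cardSuc natLeq"
    by (rule card_of_underS) (simp_all add: cardSuc_Card_order natLeq_Card_order Rep_omega1)
  then have "|underS (cardSuc natLeq) (Rep_omega1 x)| \<le>o natLeq"
    using cardSuc_ordLeq_ordLess[OF natLeq_Card_order card_of_Card_order] by blast
  then have "countable (underS (cardSuc natLeq) (Rep_omega1 x))"
    by (simp add: countable_card_le_natLeq)
  moreover have "Rep_omega1 ` {..<x} \<subseteq> underS (cardSuc natLeq) (Rep_omega1 x)"
    by (auto simp: underS_def less_omega1_iff Rep_omega1_inject)
  ultimately have "countable (Rep_omega1 ` {..<x})"
    by (rule countable_subset[rotated])
  then show ?thesis
    by (rule countable_image_inj_on) (simp add: inj_on_def Rep_omega1_inject)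
qed

unbundle no cardinal_syntax

(* None is the element o, which lies below every ordinal. The monoid sum is max. *)
type_synonym W = "omega1 option"

lemma countable_bounded_W:
  fixes A :: "W set"
  assumes "countable A"
  shows "\<exists>w. \<forall>a\<in>A. a \<le> w"
proof (rule ccontr)
  assume unbounded: "\<nexists>w. \<forall>a\<in>A. a \<le> w"
  have "\<exists>y\<in>the ` (A - {None}). x < y" for x :: omega1
  proof -
    obtain a where "a \<in> A" "Some x < a"
      using unbounded by (meson not_le)
    then show ?thesis by (cases a) force+
  qed
  then have "UNIV \<subseteq> (\<Union>y\<in>the ` (A - {None}). {..<y})" by auto
  moreover have "countable (\<Union>y\<in>the ` (A - {None}). {..<y})"
    using assms by (intro countable_UN countable_image countable_Diff countable_initial_segment_omega1)
  ultimately show False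
    using uncountable_omega1 countable_subset by blast
qed

(* Meaningful for bounded sets only, in particular for countable ones. *)
definition sup_W :: "W set \<Rightarrow> W" where
  "sup_W A = (LEAST w. \<forall>a\<in>A. a \<le> w)"

lemma sup_W_upper:
  assumes "countable A" "a \<in> A"
  shows "a \<le> sup_W A"
proof -
  have "\<forall>a\<in>A. a \<le> sup_W A"
    unfolding sup_W_def by (rule LeastI_ex[OF countable_bounded_W[OF assms(1)]])
  then show ?thesis using assms(2) by (rule bspec)
qed

lemma sup_W_least: "(\<And>a. a \<in> A \<Longrightarrow> a \<le> w) \<Longrightarrow> sup_W A \<le> w"
  unfolding sup_W_def by (rule Least_le) (rule ballI)

locale boolean_ring = ring +
  assumes idem: "x \<in> carrier R \<Longrightarrow> x \<otimes> x = x"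
begin

lemma add_self: "x \<oplus> x = \<zero>" if x: "x \<in> carrier R"
proof -
  have "(x \<oplus> x) \<otimes> (x \<oplus> x) = (x \<otimes> x \<oplus> x \<otimes> x) \<oplus> (x \<otimes> x \<oplus> x \<otimes> x)"
    using x by (simp add: l_distr r_distr)
  then have "x \<oplus> x = (x \<oplus> x) \<oplus> (x \<oplus> x)"
    unfolding idem[OF x] idem[OF add.m_closed[OF x x]] .
  from this[symmetric] show ?thesis using x by simp
qed

lemma mult_commute: "x \<otimes> y = y \<otimes> x" if x: "x \<in> carrier R" and y: "y \<in> carrier R"
proof -
  have "(x \<oplus> y) \<otimes> (x \<oplus> y) = (x \<otimes> x \<oplus> y \<otimes> y) \<oplus> (x \<otimes> y \<oplus> y \<otimes> x)"
    using x y by (simp add: l_distr r_distr a_ac)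
  then have "x \<oplus> y = (x \<oplus> y) \<oplus> (x \<otimes> y \<oplus> y \<otimes> x)"
    unfolding idem[OF x] idem[OF y] idem[OF add.m_closed[OF x y]] .
  from this[symmetric] have "x \<otimes> y \<oplus> y \<otimes> x = x \<otimes> y \<oplus> x \<otimes> y"
    using x y by (simp add: add_self)
  then show ?thesis
    using x y by simp
qed

sublocale cring
  by unfold_locales (rule mult_commute)

end

(* b lies below a iff a \<otimes> b = b *)
definition atomless :: "('a, 'm) ring_scheme \<Rightarrow> bool" where
  "atomless S \<longleftrightarrow>
     (\<forall>a\<in>carrier S. a \<noteq> \<zero>\<^bsub>S\<^esub> \<longrightarrow> (\<exists>b\<in>carrier S. a \<otimes>\<^bsub>S\<^esub> b = b \<and> b \<noteq> \<zero>\<^bsub>S\<^esub> \<and> b \<noteq> a))"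

definition W_measure :: "('a, 'm) ring_scheme \<Rightarrow> ('a \<Rightarrow> W) \<Rightarrow> bool" where
  "W_measure S \<sigma> \<longleftrightarrow>
     (\<forall>a\<in>carrier S. \<forall>b\<in>carrier S. a \<otimes>\<^bsub>S\<^esub> b = \<zero>\<^bsub>S\<^esub> \<longrightarrow> \<sigma> (a \<oplus>\<^bsub>S\<^esub> b) = max (\<sigma> a) (\<sigma> b)) \<and>
     (\<forall>a\<in>carrier S. \<sigma> a = None \<longleftrightarrow> a = \<zero>\<^bsub>S\<^esub>)"

definition set_ring :: "'a set \<Rightarrow> 'a set set \<Rightarrow> 'a set ring" where
  "set_ring U M = \<lparr>carrier = M, mult = (\<inter>), one = U, zero = {}, add = sym_diff\<rparr>"

definition compact_opens :: "'a topology \<Rightarrow> 'a set set" where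
  "compact_opens X = {A. openin X A \<and> compactin X A}"

(* The principal ideal (B) of a ring of sets M, as a ring with unit B. *)
definition principal :: "'a set set \<Rightarrow> 'a set \<Rightarrow> 'a set ring" where
  "principal M B = set_ring B {C \<in> M. C \<subseteq> B}"

(* Points are prime ideals, the complements of ultrafilters, so the clopen set of a
   consists of the ideals that do not contain a. *)
definition stone_set :: "('a, 'm) ring_scheme \<Rightarrow> 'a \<Rightarrow> 'a set set" where
  "stone_set S a = {P. primeideal P S \<and> a \<notin> P}"

definition stone_space :: "('a, 'm) ring_scheme \<Rightarrow> 'a set topology" where
  "stone_space S = topology_generated_by (stone_set S ` carrier S)"

definition cantor_set :: "real set" where
  "cantor_set = {x. \<exists>d :: nat \<Rightarrow> real. range d \<subseteq> {0, 2} \<and> (\<lambda>k. d k / 3 ^ Suc k) sums x}"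

(* Families are indexed by n \<ge> 1. A point P of X_n becomes Some (n, P), and c is None. *)
definition completion_space :: "(nat \<Rightarrow> ('a, 'm) ring_scheme) \<Rightarrow> (nat \<times> 'a set) option topology" where
  "completion_space R = Alexandroff_compactification (sum_topology (\<lambda>n. stone_space (R n)) {1..})"

definition completion_ring :: "(nat \<Rightarrow> ('a, 'm) ring_scheme) \<Rightarrow> (nat \<times> 'a set) option set set" where
  "completion_ring R = compact_opens (completion_space R)"

definition embed :: "(nat \<Rightarrow> ('a, 'm) ring_scheme) \<Rightarrow> nat \<Rightarrow> 'a \<Rightarrow> (nat \<times> 'a set) option set" where
  "embed R n a = (\<lambda>P. Some (n, P)) ` stone_set (R n) a"

definition component :: "(nat \<Rightarrow> ('a, 'm) ring_scheme) \<Rightarrow> nat \<Rightarrow> (nat \<times> 'a set) option set" where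
  "component R n = (\<lambda>P. Some (n, P)) ` topspace (stone_space (R n))"

definition tail :: "(nat \<Rightarrow> ('a, 'm) ring_scheme) \<Rightarrow> nat \<Rightarrow> (nat \<times> 'a set) option set" where
  "tail R n = insert None (\<Union>m\<in>{n..}. component R m)"

(* \<one> of R m is the compact open set X_m. Every member of completion_ring R is a finite
   disjoint union of sets embed R n a and tail R n, so these values determine \<tau> there. *)
definition is_completion ::
  "(nat \<Rightarrow> ('a, 'm) ring_scheme) \<Rightarrow> (nat \<Rightarrow> 'a \<Rightarrow> W) \<Rightarrow> ((nat \<times> 'a set) option set \<Rightarrow> W) \<Rightarrow> bool" where
  "is_completion R \<sigma> \<tau> \<longleftrightarrow>
     W_measure (set_ring (topspace (completion_space R)) (completion_ring R)) \<tau> \<and>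
     (\<forall>n\<ge>1. \<forall>a\<in>carrier (R n). \<tau> (embed R n a) = \<sigma> n a) \<and>
     (\<forall>n\<ge>1. \<tau> (tail R n) = sup_W {\<sigma> m \<one>\<^bsub>R m\<^esub> | m. m \<ge> n})"

definition completion_ring_minus ::
  "(nat \<Rightarrow> ('a, 'm) ring_scheme) \<Rightarrow> nat \<Rightarrow> (nat \<times> 'a set) option set set" where
  "completion_ring_minus R n =
     {A \<in> completion_ring R. A \<subseteq> (\<Union>m\<in>{1..} - {n}. component R m)}"

definition incompatible ::
  "(nat \<Rightarrow> ('a, 'm) ring_scheme) \<Rightarrow> (nat \<Rightarrow> 'a \<Rightarrow> W) \<Rightarrow> ((nat \<times> 'a set) option set \<Rightarrow> W) \<Rightarrow> bool" where
  "incompatible R \<sigma> \<tau> \<longleftrightarrow>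
     (\<forall>n\<ge>1. \<not> (\<exists>B\<in>completion_ring_minus R n.
        \<exists>\<alpha>\<in>ring_iso (R n) (principal (completion_ring R) B).
          \<forall>a\<in>carrier (R n). \<tau> (\<alpha> a) = \<sigma> n a))"

definition measure_cong :: "'a set set \<Rightarrow> ('a set \<Rightarrow> W) \<Rightarrow> 'a set \<Rightarrow> 'a set \<Rightarrow> bool" where
  "measure_cong M \<sigma> A B \<longleftrightarrow>
     (\<exists>\<alpha>\<in>ring_iso (principal M A) (principal M B).
        \<forall>C\<in>carrier (principal M A). \<sigma> (\<alpha> C) = \<sigma> C)"

definition pseudo_indecomposable :: "'a set set \<Rightarrow> ('a set \<Rightarrow> W) \<Rightarrow> 'a set \<Rightarrow> bool" where
  "pseudo_indecomposable M \<sigma> A \<longleftrightarrow>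
     A \<in> M \<and> (\<forall>B\<in>M. B \<subseteq> A \<longrightarrow> measure_cong M \<sigma> B A \<or> measure_cong M \<sigma> (A - B) A)"

definition measure_primitive :: "'a set set \<Rightarrow> ('a set \<Rightarrow> W) \<Rightarrow> bool" where
  "measure_primitive M \<sigma> \<longleftrightarrow>
     (\<forall>A\<in>M. \<exists>F. finite F \<and> disjoint F \<and> (\<forall>B\<in>F. pseudo_indecomposable M \<sigma> B) \<and> \<Union>F = A)"

end

theory Submission
  imports Defs
begin

text \<open>If \<open>R\<close> is primitive, some pseudo-indecomposable \<open>B\<close> contains the point \<open>c\<close>, hence all \<open>X\<^sub>n\<close> with
  \<open>n \<ge> N\<close>. A copy \<open>D\<close> of \<open>X\<^sub>N\<close> cannot contain \<open>c\<close>: otherwise \<open>D\<close> contains some \<open>X\<^sub>k\<close> with \<open>k > N\<close>,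
  whose copy inside \<open>X\<^sub>N\<close> contradicts incompatibility at \<open>k\<close>. So \<open>X\<^sub>N\<close> is not isomorphic to \<open>B\<close>, while
  an isomorphism of \<open>B\<close> with \<open>B - X\<^sub>N\<close> would yield a copy of \<open>X\<^sub>N\<close> that avoids \<open>c\<close> and \<open>X\<^sub>N\<close>, which
  incompatibility at \<open>N\<close> forbids.\<close>

section \<open>Topology: the Cantor set, disjoint sums, compact open sets\<close>

text \<open>The digit sequences form a product of two-point sets, compact by Tychonoff. The ternary
  series converges uniformly on it, so its value depends continuously on the digits and the image is
  compact.\<close>

lemma compact_cantor_set: "compact cantor_set"
proof -
  let ?D = "Pi\<^sub>E UNIV (\<lambda>_. {0, 2}) :: (nat \<Rightarrow> real) set"
  define f where "f d = (\<Sum>k. d k / 3 ^ Suc k)" for d :: "nat \<Rightarrow> real"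
  have bound: "norm (d k / 3 ^ Suc k) \<le> (1 / 3) ^ k" if "d \<in> ?D" for d k
  proof -
    have "d k \<in> {0, 2}" using that by (simp add: PiE_UNIV_domain Pi_iff)
    \<comment> \<open>The crude bound 3 cancels the extra factor in \<open>3 ^ Suc k\<close> and
      leaves a plain geometric majorant.\<close>
    then have "\<bar>d k\<bar> \<le> 3" by auto
    then show ?thesis by (simp add: power_divide field_simps)
  qed
  have summ: "summable (\<lambda>k. (1 / 3 :: real) ^ k)" by (rule summable_geometric) simp
  have "uniform_limit ?D (\<lambda>n d. \<Sum>k<n. d k / 3 ^ Suc k) f sequentially"
    unfolding f_def by (rule Weierstrass_m_test[OF bound summ])
  moreover have "continuous_on ?D (\<lambda>d. \<Sum>k<n. d k / 3 ^ Suc k)" for n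
    by (intro continuous_intros continuous_on_product_coordinates[THEN continuous_on_subset]) auto
  ultimately have cont: "continuous_on ?D f"
    by (intro uniform_limit_theorem[where F = sequentially]) auto
  have "compactin (product_topology (\<lambda>_. euclidean) UNIV) ?D"
    by (simp add: compactin_PiE)
  then have "compact ?D"
    by (simp add: euclidean_product_topology)
  then have "compact (f ` ?D)"
    by (rule compact_continuous_image[OF cont])
  moreover have "f ` ?D = cantor_set"
  proof -
    have "(\<lambda>k. d k / 3 ^ Suc k) sums f d" if "d \<in> ?D" for d
      unfolding f_def
      by (rule summable_sums) (rule summable_comparison_test'[OF summ bound[OF that]])
    then have img: "x \<in> f ` ?D \<longleftrightarrow> (\<exists>d. d \<in> ?D \<and> (\<lambda>k. d k / 3 ^ Suc k) sums x)" for x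
      using sums_unique2 by blast
    have digits: "d \<in> ?D \<longleftrightarrow> range d \<subseteq> {0, 2}" for d
      by (simp add: PiE_UNIV_domain Pi_iff image_subset_iff)
    show ?thesis
      unfolding cantor_set_def by (rule Set.set_eqI) (simp only: img digits mem_Collect_eq)
  qed
  ultimately show ?thesis by simp
qed

text \<open>Used, together with local compactness, to make the one-point compactification Hausdorff.
  Points of one summand are separated inside it; points of different summands are separated by the
  summands themselves.\<close>

lemma Hausdorff_space_sum_topology:
  assumes "\<And>i. i \<in> I \<Longrightarrow> Hausdorff_space (X i)"
  shows "Hausdorff_space (sum_topology X I)"
  unfolding Hausdorff_space_def
proof (intro allI impI, elim conjE)
  fix p q
  assume p: "p \<in> topspace (sum_topology X I)" and q: "q \<in> topspace (sum_topology X I)" and ne: "p \<noteq> q"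
  obtain i x j y where pq: "p = (i, x)" "q = (j, y)" by fastforce
  have i: "i \<in> I" "x \<in> topspace (X i)" and j: "j \<in> I" "y \<in> topspace (X j)"
    using p q pq by auto
  show "\<exists>U V. openin (sum_topology X I) U \<and> openin (sum_topology X I) V \<and> p \<in> U \<and> q \<in> V \<and> disjnt U V"
  proof (cases "i = j")
    case True
    then obtain U V where UV: "openin (X i) U" "openin (X i) V" "x \<in> U" "y \<in> V" "disjnt U V"
      using assms[OF i(1)] i j ne pq unfolding Hausdorff_space_def by metis
    have "openin (sum_topology X I) (Pair i ` U)" "openin (sum_topology X I) (Pair i ` V)"
      using UV open_map_component_injection[OF i(1), of X] unfolding open_map_def by auto
    then show ?thesis using UV pq True
      by (intro exI[of _ "Pair i ` U"] exI[of _ "Pair i ` V"]) (auto simp: disjnt_iff)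
  next
    case False
    have "openin (sum_topology X I) (Pair i ` topspace (X i))"
      "openin (sum_topology X I) (Pair j ` topspace (X j))"
      using open_map_component_injection[OF i(1), of X] open_map_component_injection[OF j(1), of X]
      unfolding open_map_def by auto
    then show ?thesis using pq False i j
      by (intro exI[of _ "Pair i ` topspace (X i)"] exI[of _ "Pair j ` topspace (X j)"])
        (auto simp: disjnt_iff)
  qed
qed

text \<open>Compactness of the space makes closed sets compact, and the KC property is the converse.
  In the clopen form closure under differences is immediate.\<close>

lemma compact_opens_compact_kc:
  assumes "compact_space X" "kc_space X"
  shows "compact_opens X = {A. openin X A \<and> closedin X A}"
  using assms closedin_compact_space unfolding compact_opens_def kc_space_def by blast

section \<open>Rings of sets and measure-preserving isomorphisms of principal ideals\<close>

lemma set_ring_simps [simp]: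
  "carrier (set_ring U M) = M" "mult (set_ring U M) = (\<inter>)" "one (set_ring U M) = U"
  "zero (set_ring U M) = {}" "add (set_ring U M) = sym_diff"
  by (simp_all add: set_ring_def)

lemma ring_set_ring:
  assumes "U \<in> M" "{} \<in> M" and "\<And>A. A \<in> M \<Longrightarrow> A \<subseteq> U"
    and "\<And>A B. A \<in> M \<Longrightarrow> B \<in> M \<Longrightarrow> A \<inter> B \<in> M"
    and "\<And>A B. A \<in> M \<Longrightarrow> B \<in> M \<Longrightarrow> sym_diff A B \<in> M"
  shows "ring (set_ring U M)"
proof (rule ringI)
  show "abelian_group (set_ring U M)"
  proof (rule abelian_groupI)
    fix A assume "A \<in> carrier (set_ring U M)"
    then show "\<exists>B\<in>carrier (set_ring U M). B \<oplus>\<^bsub>set_ring U M\<^esub> A = \<zero>\<^bsub>set_ring U M\<^esub>"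
      by (intro bexI[of _ A]) auto
  qed (use assms in auto)
  show "monoid (set_ring U M)"
    by (rule monoidI) (use assms in auto)
qed (use assms in auto)

lemma principal_simps [simp]:
  "carrier (principal M B) = {C \<in> M. C \<subseteq> B}" "mult (principal M B) = (\<inter>)"
  "one (principal M B) = B" "zero (principal M B) = {}" "add (principal M B) = sym_diff"
  by (simp_all add: principal_def)

text \<open>The inverse map works. The closure hypotheses make \<open>principal M A\<close> a ring,
  which inverting a ring isomorphism requires.\<close>

lemma measure_cong_sym:
  assumes cong: "measure_cong M \<tau> A B" and "A \<in> M" "{} \<in> M"
    and Int: "\<And>C D. C \<in> M \<Longrightarrow> D \<in> M \<Longrightarrow> C \<inter> D \<in> M"
    and diff: "\<And>C D. C \<in> M \<Longrightarrow> D \<in> M \<Longrightarrow> sym_diff C D \<in> M"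
  shows "measure_cong M \<tau> B A"
proof -
  obtain \<alpha> where \<alpha>: "\<alpha> \<in> ring_iso (principal M A) (principal M B)"
    and pres: "\<And>C. C \<in> carrier (principal M A) \<Longrightarrow> \<tau> (\<alpha> C) = \<tau> C"
    using cong unfolding measure_cong_def by blast
  have "ring (principal M A)"
    unfolding principal_def by (rule ring_set_ring) (use assms in auto)
  then have "inv_into (carrier (principal M A)) \<alpha> \<in> ring_iso (principal M B) (principal M A)"
    using \<alpha> by (rule ring_iso_set_sym)
  moreover have "\<tau> (inv_into (carrier (principal M A)) \<alpha> D) = \<tau> D"
    if "D \<in> carrier (principal M B)" for D
  proof -
    have img: "\<alpha> ` carrier (principal M A) = carrier (principal M B)"
      using ring_iso_memE(5)[OF \<alpha>] by (simp add: bij_betw_def)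
    then have D: "D \<in> \<alpha> ` carrier (principal M A)" using that by simp
    show ?thesis
      using pres[OF inv_into_into[OF D]] f_inv_into_f[OF D] by simp
  qed
  ultimately show ?thesis unfolding measure_cong_def by blast
qed

text \<open>The witness is \<open>D = \<alpha> C\<close>: an isomorphism of principal ideals
  respects inclusion in both directions, so it maps the ideal of \<open>C\<close> onto that of
  \<open>\<alpha> C\<close>.\<close>

lemma measure_cong_restrict:
  assumes cong: "measure_cong M \<tau> A B" and C: "C \<in> M" "C \<subseteq> A"
    and Int: "\<And>C D. C \<in> M \<Longrightarrow> D \<in> M \<Longrightarrow> C \<inter> D \<in> M"
    and diff: "\<And>C D. C \<in> M \<Longrightarrow> D \<in> M \<Longrightarrow> sym_diff C D \<in> M"
  shows "\<exists>D\<in>M. D \<subseteq> B \<and> measure_cong M \<tau> C D"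
proof -
  obtain \<alpha> where \<alpha>: "\<alpha> \<in> ring_iso (principal M A) (principal M B)"
    and pres: "\<And>C. C \<in> carrier (principal M A) \<Longrightarrow> \<tau> (\<alpha> C) = \<tau> C"
    using cong unfolding measure_cong_def by blast
  have mem: "\<alpha> E \<in> M" "\<alpha> E \<subseteq> B" if "E \<in> M" "E \<subseteq> A" for E
    using ring_iso_memE(1)[OF \<alpha>, of E] that by auto
  have mult: "\<alpha> (E \<inter> F) = \<alpha> E \<inter> \<alpha> F" if "E \<in> M" "E \<subseteq> A" "F \<in> M" "F \<subseteq> A" for E F
    using ring_iso_memE(2)[OF \<alpha>, of E F] that by simp
  have add: "\<alpha> (sym_diff E F) = sym_diff (\<alpha> E) (\<alpha> F)" if "E \<in> M" "E \<subseteq> A" "F \<in> M" "F \<subseteq> A" for E F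
    using ring_iso_memE(3)[OF \<alpha>, of E F] that by simp
  have bij: "bij_betw \<alpha> {E \<in> M. E \<subseteq> A} {E \<in> M. E \<subseteq> B}"
    using ring_iso_memE(5)[OF \<alpha>] by simp
  \<comment> \<open>Inclusion is the equation \<open>E \<inter> C = E\<close>, which is preserved
    since \<alpha> is multiplicative and reflected since it is injective.\<close>
  have mono: "\<alpha> E \<subseteq> \<alpha> C \<longleftrightarrow> E \<subseteq> C" if E: "E \<in> M" "E \<subseteq> A" for E
  proof -
    have "\<alpha> E \<subseteq> \<alpha> C \<longleftrightarrow> \<alpha> (E \<inter> C) = \<alpha> E" using mult[OF E C] by blast
    also have "\<dots> \<longleftrightarrow> E \<inter> C = E"
      using bij E C Int[OF E(1) C(1)] unfolding bij_betw_def
      by (intro inj_on_eq_iff[of \<alpha> "{E \<in> M. E \<subseteq> A}"]) auto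
    finally show ?thesis by blast
  qed
  have "bij_betw \<alpha> {E \<in> M. E \<subseteq> C} {E \<in> M. E \<subseteq> \<alpha> C}"
  proof (rule bij_betw_imageI)
    show "inj_on \<alpha> {E \<in> M. E \<subseteq> C}"
      using bij_betw_imp_inj_on[OF bij] by (rule inj_on_subset) (use C in auto)
    have "F \<in> \<alpha> ` {E \<in> M. E \<subseteq> C}" if "F \<in> M" "F \<subseteq> \<alpha> C" for F
    proof -
      have "F \<in> {E \<in> M. E \<subseteq> B}" using that mem[OF C] by auto
      then obtain E where "E \<in> M" "E \<subseteq> A" "F = \<alpha> E"
        using bij unfolding bij_betw_def by blast
      then show ?thesis using mono that by blast
    qed
    moreover have "\<alpha> E \<in> M \<and> \<alpha> E \<subseteq> \<alpha> C" if "E \<in> M" "E \<subseteq> C" for E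
      using mono[of E] mem[of E] that C by blast
    ultimately show "\<alpha> ` {E \<in> M. E \<subseteq> C} = {E \<in> M. E \<subseteq> \<alpha> C}" by blast
  qed
  moreover from this have "\<alpha> E \<in> M \<and> \<alpha> E \<subseteq> \<alpha> C" if "E \<in> M" "E \<subseteq> C" for E
    using that unfolding bij_betw_def by blast
  ultimately have "\<alpha> \<in> ring_iso (principal M C) (principal M (\<alpha> C))"
    using C by (intro ring_iso_memI) (auto simp: mult add subset_trans[OF _ C(2)])
  then have "measure_cong M \<tau> C (\<alpha> C)"
    unfolding measure_cong_def by (rule bexI[rotated]) (use pres C in auto)
  then show ?thesis using mem[OF C] by blast
qed

section \<open>Stone spaces of Boolean rings\<close>

context boolean_ring
begin

lemma prime_ideal_facts:
  assumes "primeideal P R"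
  shows "\<zero> \<in> P" "\<one> \<notin> P"
    "\<And>a b. a \<in> carrier R \<Longrightarrow> b \<in> carrier R \<Longrightarrow> a \<otimes> b \<in> P \<longleftrightarrow> a \<in> P \<or> b \<in> P"
    "\<And>a b. a \<in> P \<Longrightarrow> b \<in> P \<Longrightarrow> a \<oplus> b \<in> P"
proof -
  interpret P: primeideal P R by fact
  show "\<zero> \<in> P" by (rule P.zero_closed)
  show "\<one> \<notin> P" using P.I_notcarr P.one_imp_carrier[symmetric] by (rule contrapos_nn)
  show "a \<otimes> b \<in> P \<longleftrightarrow> a \<in> P \<or> b \<in> P" if "a \<in> carrier R" "b \<in> carrier R" for a b
    using that P.I_prime[of a b] P.I_l_closed[of b a] P.I_r_closed[of a b] by argo
  show "a \<oplus> b \<in> P" if "a \<in> P" "b \<in> P" for a b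
    using that by (rule P.a_closed)
qed

lemma stone_set_zero: "stone_set R \<zero> = {}"
  using prime_ideal_facts(1) by (auto simp: stone_set_def)

lemma stone_set_mult:
  "a \<in> carrier R \<Longrightarrow> b \<in> carrier R \<Longrightarrow> stone_set R (a \<otimes> b) = stone_set R a \<inter> stone_set R b"
  using prime_ideal_facts(3) by (auto simp: stone_set_def)

text \<open>Modulo a prime ideal a Boolean ring has two elements, so a sum lies in \<open>P\<close>
  iff both or neither of its terms do. For the case of neither,
  \<open>(a \<otimes> b) \<otimes> (a \<oplus> b)\<close> vanishes, so primeness forces the sum into
  \<open>P\<close>; the mixed cases follow because adding a term to the sum returns the other
  term.\<close>

lemma stone_set_add:
  assumes a: "a \<in> carrier R" and b: "b \<in> carrier R"
  shows "stone_set R (a \<oplus> b) = sym_diff (stone_set R a) (stone_set R b)"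
proof -
  have "a \<oplus> b \<in> P \<longleftrightarrow> (a \<in> P \<longleftrightarrow> b \<in> P)" if P: "primeideal P R" for P
  proof -
    have "(a \<otimes> b) \<otimes> (a \<oplus> b) = (a \<otimes> a) \<otimes> b \<oplus> a \<otimes> (b \<otimes> b)"
      using a b by algebra
    then have "(a \<otimes> b) \<otimes> (a \<oplus> b) = \<zero>"
      using a b by (simp add: idem add_self)
    then have 1: "a \<in> P \<or> b \<in> P \<or> a \<oplus> b \<in> P"
      using prime_ideal_facts(1,3)[OF P] a b by (metis m_closed a_closed)
    have "a \<oplus> (a \<oplus> b) = b" "b \<oplus> (a \<oplus> b) = a"
      using a b by (simp_all add: a_assoc[symmetric] add_self) (simp add: a_lcomm add_self a_comm a_assoc)
    then have 2: "a \<in> P \<Longrightarrow> a \<oplus> b \<in> P \<Longrightarrow> b \<in> P" "b \<in> P \<Longrightarrow> a \<oplus> b \<in> P \<Longrightarrow> a \<in> P"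
      using prime_ideal_facts(4)[OF P] by metis+
    show ?thesis using 1 2 prime_ideal_facts(4)[OF P] by blast
  qed
  then show ?thesis by (auto simp: stone_set_def)
qed

lemma topspace_stone_space: "topspace (stone_space R) = stone_set R \<one>"
proof -
  have "stone_set R a \<subseteq> stone_set R \<one>" for a
    using prime_ideal_facts(2) by (auto simp: stone_set_def)
  then show ?thesis
    unfolding stone_space_def topology_generated_by_topspace by blast
qed

lemma openin_stone_set: "a \<in> carrier R \<Longrightarrow> openin (stone_space R) (stone_set R a)"
  unfolding stone_space_def by (rule topology_generated_by_Basis) simp

lemma closedin_stone_set:
  assumes "a \<in> carrier R" shows "closedin (stone_space R) (stone_set R a)"
proof -
  have sub: "stone_set R a \<subseteq> topspace (stone_space R)"
    by (rule openin_subset[OF openin_stone_set[OF assms]])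
  then have "topspace (stone_space R) - stone_set R a = stone_set R (\<one> \<oplus> a)"
    using assms by (auto simp: stone_set_add topspace_stone_space)
  then show ?thesis
    unfolding closedin_def using sub openin_stone_set assms by simp
qed

text \<open>The generating sets are closed under finite intersections by
  \<open>stone_set_mult\<close>, so the subbasis is already a basis.\<close>

lemma stone_space_basis:
  assumes "openin (stone_space R) U" "P \<in> U"
  shows "\<exists>a\<in>carrier R. P \<in> stone_set R a \<and> stone_set R a \<subseteq> U"
proof -
  have "generate_topology_on (stone_set R ` carrier R) U"
    using assms(1) unfolding stone_space_def by (rule openin_topology_generated_by)
  then show ?thesis using assms(2)
  proof (induction arbitrary: P)
    case (Int U V)
    then obtain a b where "a \<in> carrier R" "P \<in> stone_set R a" "stone_set R a \<subseteq> U"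
      "b \<in> carrier R" "P \<in> stone_set R b" "stone_set R b \<subseteq> V" by blast
    then show ?case by (intro bexI[of _ "a \<otimes> b"]) (auto simp: stone_set_mult)
  next
    case (UN K)
    from UN.prems obtain V where V: "V \<in> K" "P \<in> V" by (rule UnionE)
    with UN.IH obtain a where "a \<in> carrier R" "P \<in> stone_set R a" "stone_set R a \<subseteq> V"
      by meson
    with V(1) show ?case by (intro bexI[of _ a]) auto
  next
    case (Basis U)
    then show ?case by blast
  qed simp
qed

lemma finite_Union_stone_set:
  assumes "finite A" "A \<subseteq> carrier R"
  shows "\<exists>c\<in>carrier R. (\<Union>a\<in>A. stone_set R a) = stone_set R c"
  using assms
proof (induction A rule: finite_induct)
  case empty
  show ?case by (intro bexI[of _ \<zero>]) (auto simp: stone_set_zero)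
next
  case (insert a A)
  then obtain c where c: "c \<in> carrier R" "(\<Union>a\<in>A. stone_set R a) = stone_set R c" by auto
  have a: "a \<in> carrier R" using insert.prems by simp
  \<comment> \<open>This element is the Boolean join of \<open>a\<close> and \<open>c\<close>
    written with ring operations.\<close>
  have "stone_set R ((a \<oplus> c) \<oplus> a \<otimes> c) = stone_set R a \<union> stone_set R c"
    unfolding stone_set_add[OF a_closed[OF a c(1)] m_closed[OF a c(1)]]
      stone_set_add[OF a c(1)] stone_set_mult[OF a c(1)] by blast
  then have "(\<Union>b\<in>insert a A. stone_set R b) = stone_set R ((a \<oplus> c) \<oplus> a \<otimes> c)"
    using c(2) by simp
  then show ?case by (rule bexI) (rule a_closed[OF a_closed[OF a c(1)] m_closed[OF a c(1)]])
qed

text \<open>Openness writes \<open>K\<close> as a union of basic sets, compactness reduces this to a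
  finite union, and finite unions of basic sets are again basic.\<close>

lemma compact_open_stone_set:
  assumes "openin (stone_space R) K" "compactin (stone_space R) K"
  shows "\<exists>c\<in>carrier R. K = stone_set R c"
proof -
  let ?\<U> = "stone_set R ` {a \<in> carrier R. stone_set R a \<subseteq> K}"
  have "K \<subseteq> \<Union>?\<U>" using stone_space_basis[OF assms(1)] by blast
  moreover have "\<And>U. U \<in> ?\<U> \<Longrightarrow> openin (stone_space R) U" using openin_stone_set by blast
  ultimately have "\<exists>\<F>. finite \<F> \<and> \<F> \<subseteq> ?\<U> \<and> K \<subseteq> \<Union>\<F>"
    by (intro compactinD[OF assms(2)])
  then obtain \<F> where \<F>: "finite \<F>" "\<F> \<subseteq> ?\<U>" "K \<subseteq> \<Union>\<F>" by (elim exE conjE)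
  obtain A where A: "A \<subseteq> {a \<in> carrier R. stone_set R a \<subseteq> K}" "finite A" "\<F> = stone_set R ` A"
    using finite_subset_image[OF \<F>(1,2)] by (elim exE conjE)
  then have "K = (\<Union>a\<in>A. stone_set R a)" using \<F> by auto
  then show ?thesis using finite_Union_stone_set[OF A(2)] A(1) by auto
qed

end

section \<open>The completion space and its clopen sets\<close>

locale stone_family =
  fixes R :: "nat \<Rightarrow> ('a, 'm) ring_scheme"
  assumes boolean: "n \<ge> 1 \<Longrightarrow> boolean_ring (R n)"
    and cantor: "n \<ge> 1 \<Longrightarrow> stone_space (R n) homeomorphic_space top_of_set cantor_set"
begin

abbreviation "M \<equiv> completion_ring R"

abbreviation "Y \<equiv> completion_space R"

lemma compact_stone_space: "compact_space (stone_space (R n))" if "n \<ge> 1"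
  using homeomorphic_compact_space[OF cantor[OF that]] compact_cantor_set
  by (simp add: compact_space_subtopology)

lemma Hausdorff_stone_space: "Hausdorff_space (stone_space (R n))" if "n \<ge> 1"
  using homeomorphic_Hausdorff_space[OF cantor[OF that]]
  by (simp add: Hausdorff_space_subtopology)

text \<open>The disjoint sum of compact Hausdorff spaces is locally compact Hausdorff, so its
  one-point compactification is compact Hausdorff.\<close>

lemma completion_ring_clopen: "M = {A. openin Y A \<and> closedin Y A}"
proof -
  have "Hausdorff_space Y"
    unfolding completion_space_def Hausdorff_space_Alexandroff_compactification
    by (auto simp: locally_compact_space_sum_topology
        intro!: Hausdorff_space_sum_topology Hausdorff_stone_space
          compact_imp_locally_compact_space compact_stone_space)
  then show ?thesis
    unfolding completion_ring_def
    by (intro compact_opens_compact_kc Hausdorff_imp_kc_space) (simp_all add: completion_space_def)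
qed

lemma empty_mem: "{} \<in> M"
  by (simp add: completion_ring_clopen)

lemma topspace_mem: "topspace Y \<in> M"
  by (simp add: completion_ring_clopen)

lemma Int_mem: "A \<in> M \<Longrightarrow> B \<in> M \<Longrightarrow> A \<inter> B \<in> M"
  by (auto simp: completion_ring_clopen)

lemma Diff_mem: "A \<in> M \<Longrightarrow> B \<in> M \<Longrightarrow> A - B \<in> M"
  by (auto simp: completion_ring_clopen intro: openin_diff closedin_diff)

lemma sym_diff_mem: "A \<in> M \<Longrightarrow> B \<in> M \<Longrightarrow> sym_diff A B \<in> M"
  by (auto simp: completion_ring_clopen intro: openin_diff closedin_diff)

lemma embed_mem:
  assumes n: "n \<ge> 1" and a: "a \<in> carrier (R n)"
  shows "embed R n a \<in> M"
proof -
  interpret boolean_ring "R n" by (rule boolean[OF n])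
  let ?S = "sum_topology (\<lambda>n. stone_space (R n)) {1..}"
  let ?K = "Pair n ` stone_set (R n) a"
  have eq: "embed R n a = Some ` ?K" by (simp add: embed_def image_image)
  have "openin ?S ?K"
    using open_map_component_injection[of n "{1..}" "\<lambda>n. stone_space (R n)"] n openin_stone_set[OF a]
    unfolding open_map_def by auto
  moreover have "closedin ?S ?K"
    using closed_map_component_injection[of n "{1..}" "\<lambda>n. stone_space (R n)"] n closedin_stone_set[OF a]
    unfolding closed_map_def by auto
  \<comment> \<open>Compactness is what keeps the point at infinity out of the closure of the
    image.\<close>
  moreover have "compactin ?S ?K"
    using n closedin_compact_space[OF compact_stone_space[OF n] closedin_stone_set[OF a]]
    by (intro image_compactin[OF _ continuous_map_component_injection]) auto
  ultimately show ?thesis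
    unfolding completion_ring_clopen completion_space_def eq by simp
qed

lemma component_eq_embed: "n \<ge> 1 \<Longrightarrow> component R n = embed R n \<one>\<^bsub>R n\<^esub>"
  using boolean_ring.topspace_stone_space[OF boolean] by (simp add: component_def embed_def)

lemma component_mem: "component R n \<in> M" if "n \<ge> 1"
proof -
  interpret boolean_ring "R n" by (rule boolean[OF that])
  show ?thesis using component_eq_embed[OF that] embed_mem[OF that one_closed] by simp
qed

lemma component_disjoint: "m \<noteq> n \<Longrightarrow> component R m \<inter> component R n = {}"
  by (auto simp: component_def)

lemma topspace_completion: "topspace Y = insert None (\<Union>n\<in>{1..}. component R n)"
  by (auto simp: completion_space_def component_def image_iff)

text \<open>The complement of \<open>A\<close> is compact and misses c, so it is covered by the open
  sets X_n. Finitely many of them suffice, and every later component lies in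
  \<open>A\<close>.\<close>

lemma None_mem_imp_components:
  assumes A: "A \<in> M" "None \<in> A"
  shows "\<exists>N\<ge>1. \<forall>n\<ge>N. component R n \<subseteq> A"
proof -
  have comp: "compactin Y (topspace Y - A)"
    using Diff_mem[OF topspace_mem A(1)] unfolding completion_ring_def compact_opens_def by simp
  have "\<And>U. U \<in> component R ` {1..} \<Longrightarrow> openin Y U"
    using component_mem by (auto simp: completion_ring_clopen)
  moreover have "topspace Y - A \<subseteq> \<Union>(component R ` {1..})"
    using A(2) by (auto simp: topspace_completion)
  ultimately have "\<exists>\<F>. finite \<F> \<and> \<F> \<subseteq> component R ` {1..} \<and> topspace Y - A \<subseteq> \<Union>\<F>"
    by (intro compactinD[OF comp])
  then obtain \<F> where \<F>: "finite \<F>" "\<F> \<subseteq> component R ` {1..}" "topspace Y - A \<subseteq> \<Union>\<F>"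
    by (elim exE conjE)
  obtain I where I: "I \<subseteq> {1..}" "finite I" "\<F> = component R ` I"
    using finite_subset_image[OF \<F>(1,2)] by (elim exE conjE)
  obtain N where N: "\<And>i. i \<in> I \<Longrightarrow> i < N"
    using finite_nat_set_iff_bounded I(2) by auto
  \<comment> \<open>Starting at \<open>Suc N\<close> keeps the index positive even when
    \<open>N\<close> is 0.\<close>
  have "component R n \<subseteq> A" if n: "n \<ge> Suc N" for n
  proof
    fix x assume x: "x \<in> component R n"
    then have "x \<in> topspace Y" using n by (auto simp: topspace_completion)
    moreover have "x \<notin> \<Union>\<F>"
      using x I N n component_disjoint by (fastforce simp: component_def)
    ultimately show "x \<in> A" using \<F>(3) by blast
  qed
  then show ?thesis by (intro exI[of _ "Suc N"]) auto
qed

text \<open>The preimage of \<open>C\<close> under the continuous inclusion of X_n is clopen in a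
  compact space, hence compact open, hence a basic Stone set.\<close>

lemma sub_component_embed:
  assumes n: "n \<ge> 1" and C: "C \<in> M" "C \<subseteq> component R n"
  shows "\<exists>c\<in>carrier (R n). C = embed R n c"
proof -
  interpret boolean_ring "R n" by (rule boolean[OF n])
  let ?f = "\<lambda>P. Some (n, P)"
  have "continuous_map (stone_space (R n)) Y (Some \<circ> Pair n)"
    unfolding completion_space_def using n
    by (intro continuous_map_compose[OF continuous_map_component_injection continuous_map_Some]) auto
  then have cont: "continuous_map (stone_space (R n)) Y ?f" by (simp add: comp_def)
  let ?K = "{P \<in> topspace (stone_space (R n)). ?f P \<in> C}"
  have "openin (stone_space (R n)) ?K" "closedin (stone_space (R n)) ?K"
    using C(1) openin_continuous_map_preimage[OF cont] closedin_continuous_map_preimage[OF cont]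
    by (simp_all add: completion_ring_clopen)
  then obtain c where c: "c \<in> carrier (R n)" "?K = stone_set (R n) c"
    using compact_open_stone_set closedin_compact_space[OF compact_stone_space[OF n]] by blast
  have "C = ?f ` ?K" using C(2) by (auto simp: component_def)
  then show ?thesis using c by (auto simp: embed_def)
qed

end

section \<open>The completed measure and incompatibility\<close>

locale completion = stone_family +
  fixes \<sigma> :: "nat \<Rightarrow> 'a \<Rightarrow> W" and \<tau> :: "(nat \<times> 'a set) option set \<Rightarrow> W"
  assumes measure: "n \<ge> 1 \<Longrightarrow> W_measure (R n) (\<sigma> n)"
    and completion: "is_completion R \<sigma> \<tau>"
begin

lemma measure_embed: "n \<ge> 1 \<Longrightarrow> a \<in> carrier (R n) \<Longrightarrow> \<tau> (embed R n a) = \<sigma> n a"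
  using completion by (simp add: is_completion_def)

text \<open>Injectivity of the Stone representation needs no prime ideal theorem here: an element whose
  Stone set is empty has measure \<open>o\<close>, hence is zero.\<close>

lemma embed_eq_empty_iff:
  assumes n: "n \<ge> 1" and a: "a \<in> carrier (R n)"
  shows "embed R n a = {} \<longleftrightarrow> a = \<zero>\<^bsub>R n\<^esub>"
proof -
  interpret boolean_ring "R n" by (rule boolean[OF n])
  have "\<tau> {} = None"
    using completion empty_mem by (auto simp: is_completion_def W_measure_def)
  then have "embed R n a = {} \<Longrightarrow> \<sigma> n a = None"
    using measure_embed[OF n a] by simp
  then show ?thesis
    using measure[OF n] a stone_set_zero by (auto simp: W_measure_def embed_def)
qed

text \<open>This justifies viewing \<open>R n\<close> as the ring of compact open subsets of X_n.
  Injectivity comes from the trivial kernel, surjectivity from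
  \<open>sub_component_embed\<close>.\<close>

lemma embed_iso:
  assumes n: "n \<ge> 1"
  shows "embed R n \<in> ring_iso (R n) (principal M (component R n))"
proof -
  interpret boolean_ring "R n" by (rule boolean[OF n])
  let ?f = "\<lambda>P. Some (n, P)"
  have inj: "inj ?f" by (simp add: inj_def)
  have add: "embed R n (a \<oplus>\<^bsub>R n\<^esub> b) = sym_diff (embed R n a) (embed R n b)"
    if "a \<in> carrier (R n)" "b \<in> carrier (R n)" for a b
    using that by (simp add: embed_def stone_set_add image_Un image_set_diff[OF inj])
  have mult: "embed R n (a \<otimes>\<^bsub>R n\<^esub> b) = embed R n a \<inter> embed R n b"
    if "a \<in> carrier (R n)" "b \<in> carrier (R n)" for a b
    using that by (simp add: embed_def stone_set_mult image_Int[OF inj])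
  have sub: "embed R n a \<subseteq> component R n" if "a \<in> carrier (R n)" for a
    using openin_subset[OF openin_stone_set[OF that]] by (auto simp: embed_def component_def)
  have "bij_betw (embed R n) (carrier (R n)) {C \<in> M. C \<subseteq> component R n}"
  proof (rule bij_betw_imageI)
    show "inj_on (embed R n) (carrier (R n))"
    proof (rule inj_onI)
      fix a b
      assume ab: "a \<in> carrier (R n)" "b \<in> carrier (R n)" "embed R n a = embed R n b"
      then have "embed R n (a \<oplus>\<^bsub>R n\<^esub> b) = {}" by (simp add: add)
      \<comment> \<open>Both sides are zero, the right one by characteristic 2, so \<open>b\<close>
        can be cancelled.\<close>
      then have "a \<oplus>\<^bsub>R n\<^esub> b = b \<oplus>\<^bsub>R n\<^esub> b"
        using ab embed_eq_empty_iff[OF n, of "a \<oplus>\<^bsub>R n\<^esub> b"] by (simp add: add_self)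
      then show "a = b" using ab by simp
    qed
    show "embed R n ` carrier (R n) = {C \<in> M. C \<subseteq> component R n}"
      using sub embed_mem[OF n] sub_component_embed[OF n] by blast
  qed
  then show ?thesis
    using sub embed_mem[OF n]
    by (intro ring_iso_memI) (auto simp: add mult component_eq_embed[OF n])
qed

text \<open>Precomposing with \<open>embed_iso\<close> turns incompatibility, phrased for the
  abstract ring \<open>R n\<close>, into a statement about \<open>measure_cong\<close> inside the
  completion. Avoiding c and X_n is membership of \<open>B\<close> in R_{-n}.\<close>

lemma incompatible_component:
  assumes "incompatible R \<sigma> \<tau>" and n: "n \<ge> 1"
    and B: "B \<in> M" "None \<notin> B" "B \<inter> component R n = {}"
  shows "\<not> measure_cong M \<tau> (component R n) B"
proof
  assume "measure_cong M \<tau> (component R n) B"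
  then obtain \<alpha> where \<alpha>: "\<alpha> \<in> ring_iso (principal M (component R n)) (principal M B)"
    and pres: "\<forall>C\<in>carrier (principal M (component R n)). \<tau> (\<alpha> C) = \<tau> C"
    unfolding measure_cong_def by blast
  have "\<alpha> \<circ> embed R n \<in> ring_iso (R n) (principal M B)"
    by (rule ring_iso_set_trans[OF embed_iso[OF n] \<alpha>])
  moreover have "\<forall>a\<in>carrier (R n). \<tau> ((\<alpha> \<circ> embed R n) a) = \<sigma> n a"
    using pres ring_iso_memE(1)[OF embed_iso[OF n]] measure_embed[OF n] by simp
  moreover have "B \<in> completion_ring_minus R n"
  proof -
    have "B \<subseteq> topspace Y" using B(1) openin_subset by (auto simp: completion_ring_clopen)
    then show ?thesis
      using B by (auto simp: completion_ring_minus_def topspace_completion)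
  qed
  ultimately show False
    using assms(1) n unfolding incompatible_def by blast
qed

end

section \<open>Failure of primitivity at the point c\<close>

theorem theorem19:
  fixes R :: "nat \<Rightarrow> ('a, 'm) ring_scheme"
    and \<sigma> :: "nat \<Rightarrow> 'a \<Rightarrow> W"
    and \<tau> :: "(nat \<times> 'a set) option set \<Rightarrow> W"
  assumes "\<And>n. n \<ge> 1 \<Longrightarrow> boolean_ring (R n)"
    and "\<And>n. n \<ge> 1 \<Longrightarrow> countable (carrier (R n))"
    and "\<And>n. n \<ge> 1 \<Longrightarrow> atomless (R n)"
    and "\<And>n. n \<ge> 1 \<Longrightarrow> stone_space (R n) homeomorphic_space top_of_set cantor_set"
    and "\<And>n. n \<ge> 1 \<Longrightarrow> W_measure (R n) (\<sigma> n)"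
    and "is_completion R \<sigma> \<tau>"
    and "incompatible R \<sigma> \<tau>"
  shows "\<not> measure_primitive (completion_ring R) \<tau>"
proof
  interpret completion R \<sigma> \<tau>
    using assms(1,4-6) by (auto intro!: completion.intro stone_family.intro completion_axioms.intro)
  note incompat = incompatible_component[OF assms(7)]
  have sym: "measure_cong M \<tau> B A" if "measure_cong M \<tau> A B" "A \<in> M" for A B
    using that empty_mem Int_mem sym_diff_mem by (rule measure_cong_sym)
  have restrict: "\<exists>D\<in>M. D \<subseteq> B \<and> measure_cong M \<tau> C D"
    if "measure_cong M \<tau> A B" "C \<in> M" "C \<subseteq> A" for A B C
    using that Int_mem sym_diff_mem by (rule measure_cong_restrict)
  assume "measure_primitive M \<tau>"
  then have "\<exists>F. finite F \<and> disjoint F \<and> (\<forall>B\<in>F. pseudo_indecomposable M \<tau> B) \<and> \<Union>F = topspace Y"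
    using topspace_mem unfolding measure_primitive_def by (rule bspec)
  then obtain F where F: "\<forall>B\<in>F. pseudo_indecomposable M \<tau> B" "\<Union>F = topspace Y"
    by (elim exE conjE)
  have "None \<in> \<Union>F" unfolding F(2) topspace_completion by simp
  then obtain B where B: "pseudo_indecomposable M \<tau> B" "None \<in> B" using F(1) by blast
  then have BM: "B \<in> M" by (simp add: pseudo_indecomposable_def)
  then obtain N where N: "N \<ge> 1" "\<And>n. n \<ge> N \<Longrightarrow> component R n \<subseteq> B"
    using None_mem_imp_components B(2) by blast
  \<comment> \<open>\<open>D\<close> is arbitrary because this serves twice: for \<open>B\<close>
    itself and for a copy of X_N inside \<open>B - component R N\<close>.\<close>
  have no_cong: False
    if cong: "measure_cong M \<tau> (component R N) D" and D: "D \<in> M" "None \<in> D" for D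
  proof -
    obtain K where K: "\<And>k. k \<ge> K \<Longrightarrow> component R k \<subseteq> D"
      using None_mem_imp_components[OF D] by blast
    \<comment> \<open>The index must be past \<open>K\<close>, so that X_k lies in \<open>D\<close>,
      and differ from \<open>N\<close>, so that X_k is disjoint from X_N.\<close>
    define k where "k = max K (Suc N)"
    have k: "k \<ge> 1" "k \<noteq> N" "component R k \<subseteq> D" using K by (auto simp: k_def)
    have "measure_cong M \<tau> D (component R N)"
      by (rule sym[OF cong component_mem[OF N(1)]])
    from restrict[OF this component_mem[OF k(1)] k(3)]
    obtain E where E: "E \<in> M" "E \<subseteq> component R N" "measure_cong M \<tau> (component R k) E" by blast
    moreover have "None \<notin> E" "E \<inter> component R k = {}"
      using E(2) component_disjoint[OF k(2)] by (auto simp: component_def)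
    ultimately show False using incompat[OF k(1)] by blast
  qed
  have "measure_cong M \<tau> (component R N) B \<or> measure_cong M \<tau> (B - component R N) B"
    using B(1) component_mem[OF N(1)] N(2) unfolding pseudo_indecomposable_def by blast
  then show False
  proof
    assume "measure_cong M \<tau> (component R N) B"
    then show False using no_cong BM B(2) by blast
  next
    assume "measure_cong M \<tau> (B - component R N) B"
    then have "measure_cong M \<tau> B (B - component R N)"
      by (rule sym) (rule Diff_mem[OF BM component_mem[OF N(1)]])
    from restrict[OF this component_mem[OF N(1)] N(2)[OF order_refl]]
    obtain D where D: "D \<in> M" "D \<subseteq> B - component R N" "measure_cong M \<tau> (component R N) D" by blast
    \<comment> \<open>If \<open>D\<close> contains c, \<open>no_cong\<close> applies; otherwise
      \<open>D\<close> avoids both c and X_N and \<open>incompat\<close> applies.\<close>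
    then show False
      using no_cong incompat[OF N(1) D(1)] by blast
  qed
qed

end
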